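(* Let $r\ge 1$ be an integer and let $G$ be a finite simple connected non-bipartite graph with $m$ edges, where $m \geq (240r)^2$, and with spectral radius $\rho=\rho(G)$. Suppose that $G$ is $B_{r+1}$-free. Then $$\rho^2 < m - 1 + \frac{2}{\rho - 1},$$ unless $G \cong S^{+}_{m,s}$ for some $s \in \{1, 2, \ldots, r\}$.
   Context: All graphs are finite, simple and connected, and have no isolated vertices. For a graph $G$, $\rho(G)$ denotes its spectral radius, i.e. the largest eigenvalue of its adjacency matrix. For an integer $k\ge 1$, the book of size $k$, denoted $B_k$, is the graph formed by $k$ triangles sharing a common edge. A graph is $B_k$-free if it does not contain $B_k$ as a (not necessarily induced) subgraph. For a positive integer $s$ dividing $m-1$, $S^{+}_{m,s}$ denotes the graph with $m$ edges obtained from the complete bipartite graph $K_{s,(m-1)/s}$ by adding one edge between two vertices of the part of size $\frac{1}{s}(m-1)$ (in particular, $S^{+}_{m,1}$ is the star $K_{1,m-1}$ with one edge added between two leaves). The graph $S^{+}_{m,s}$ is defined only when $s$ divides $m-1$. *)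

theory Defs
  imports
    "Graph_Theory.Graph_Theory"
    "Jordan_Normal_Form.Char_Poly"
begin

text \<open>
  A finite simple graph is a \<^locale>\<open>pair_graph\<close>: a finite vertex set with a symmetric, irreflexive
  set of arcs. An undirected edge is thus a pair of opposite arcs, and edges are counted as
  two-element sets of vertices.
\<close>

definition edges :: "'a pair_pre_digraph \<Rightarrow> 'a set set" where
  "edges G = (\<lambda>(u, v). {u, v}) ` parcs G"

definition bipartite :: "'a pair_pre_digraph \<Rightarrow> bool" where
  "bipartite G \<longleftrightarrow>
     (\<exists>U W. pverts G = U \<union> W \<and> U \<inter> W = {} \<and> parcs G \<subseteq> U \<times> W \<union> W \<times> U)"

definition adjacency_mat :: "'a pair_pre_digraph \<Rightarrow> 'a list \<Rightarrow> real mat" where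
  "adjacency_mat G vs =
     mat (length vs) (length vs) (\<lambda>(i, j). if (vs ! i, vs ! j) \<in> parcs G then 1 else 0)"

text \<open>
  The rows and columns are ordered by an arbitrary enumeration of the vertices; any other
  enumeration gives a permutation-similar matrix, hence the same eigenvalues. The matrix is
  real symmetric, so no eigenvalue is lost by considering only the real ones.
\<close>

definition adj_spectral_radius :: "'a pair_pre_digraph \<Rightarrow> real" where
  "adj_spectral_radius G =
     Max {k. eigenvalue (adjacency_mat G (SOME vs. distinct vs \<and> set vs = pverts G)) k}"

text \<open>The common edge is \<open>{0, 1}\<close>, the apexes of the triangles are \<open>2, \<dots>, k + 1\<close>.\<close>

definition book :: "nat \<Rightarrow> nat pair_pre_digraph" where
  "book k = \<lparr> pverts = {..<k + 2},
     parcs = {(0, 1), (1, 0)} \<union> {0, 1} \<times> {2..<k + 2} \<union> {2..<k + 2} \<times> {0, 1} \<rparr>"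

definition book_free :: "nat \<Rightarrow> 'a pair_pre_digraph \<Rightarrow> bool" where
  "book_free k G \<longleftrightarrow>
     \<not> (\<exists>H :: 'a pair_pre_digraph. subgraph H G \<and> digraph_iso (book k) H)"

definition complete_bipartite :: "nat \<Rightarrow> nat \<Rightarrow> nat pair_pre_digraph" where
  "complete_bipartite s t = \<lparr> pverts = {..<s + t},
     parcs = {..<s} \<times> {s..<s + t} \<union> {s..<s + t} \<times> {..<s} \<rparr>"

text \<open>
  The edge \<open>{s, s + 1}\<close> is added inside the second part. This is the graph \<open>S\<^sup>+\<^bsub>m,s\<^esub>\<close> only if
  \<open>s\<close> divides \<open>m - 1\<close> and \<open>(m - 1) / s \<ge> 2\<close>.
\<close>

definition S_plus :: "nat \<Rightarrow> nat \<Rightarrow> nat pair_pre_digraph" where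
  "S_plus m s = (let K = complete_bipartite s ((m - 1) div s)
     in K\<lparr> parcs := parcs K \<union> {(s, s + 1), (s + 1, s)} \<rparr>)"

lemma pair_graph_book: "pair_graph (book k)"
  by unfold_locales (auto simp: book_def symmetric_def intro!: symI)

lemma complete_bipartite_digraph_complete_bipartite: "K\<^bsub>s,t\<^esub> (complete_bipartite s t)"
proof -
  have "finite (pverts (complete_bipartite s t))"
    by (simp add: complete_bipartite_def)
  moreover have "pverts (complete_bipartite s t) = {..<s} \<union> {s..<s + t}"
    by (auto simp: complete_bipartite_def)
  moreover have "{..<s} \<inter> {s..<s + t} = {}" "card {..<s} = s" "card {s..<s + t} = t"
    by auto
  moreover have "parcs (complete_bipartite s t)
      = {..<s} \<times> {s..<s + t} \<union> {s..<s + t} \<times> {..<s}"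
    by (simp add: complete_bipartite_def)
  ultimately show ?thesis
    unfolding complete_bipartite_digraph_pair_def by blast
qed

lemma pair_graph_S_plus:
  assumes "2 \<le> (m - 1) div s"
  shows "pair_graph (S_plus m s)"
  using assms
  by unfold_locales
    (auto simp: S_plus_def complete_bipartite_def Let_def symmetric_def intro!: symI)

lemma card_edges_S_plus:
  assumes "s dvd m - 1" "2 \<le> (m - 1) div s"
  shows "card (edges (S_plus m s)) = m"
proof -
  define t where "t = (m - 1) div s"
  have m: "m = s * t + 1"
    using assms by (cases m) (auto simp: t_def)
  let ?f = "\<lambda>(u, v). {u, v :: nat}"
  have "edges (S_plus m s) = insert {s, s + 1} (?f ` ({..<s} \<times> {s..<s + t}))"
    by (auto simp: edges_def S_plus_def complete_bipartite_def Let_def t_def insert_commute image_iff)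
  moreover have "{s, s + 1} \<notin> ?f ` ({..<s} \<times> {s..<s + t})"
    by (auto simp: doubleton_eq_iff)
  moreover have "inj_on ?f ({..<s} \<times> {s..<s + t})"
    by (auto simp: inj_on_def doubleton_eq_iff)
  ultimately show ?thesis
    by (simp add: card_image m)
qed

end

(*
  Let x be a nonnegative eigenvector for rho, scaled so that its maximum is x u = 1; let N be the
  neighbourhood of u and W the set of the remaining vertices. Evaluating A^2 x at u gives

    2 (m - rho^2) = sum over arcs vw inside N of (1 - x v - x w)  +  2 * sum over z in W of loss z,

  where loss z = d_W(z) / 2 + d_N(z) (1 - x z). Only an arc inside N with x v + x w > 1 can
  contribute negatively. Then the larger end w has about rho/2 neighbours in W, at most r of which
  are adjacent to the smaller end v, and these nonadjacent pairs cost far more through the loss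
  than the arc gains. Hence m - rho^2 >= 1 unless W is independent, N spans a single edge and all
  pairs between N and W are adjacent, that is, unless G is S_plus.
*)
theory Submission
  imports Defs "HOL-Analysis.Function_Topology"
begin

section \<open>The top eigenvector of a symmetric relation\<close>

text \<open>The proof works with \<rho>^2 > m - 1, that is, with the doubled deficit being below 2.
  A lone edge \<open>ab\<close> inside \<open>N\<close> contributes 2 (1 - x a - x b), slightly less
  than 2, so this threshold admits one such edge, and any further defect has to be shown to cost
  enough. The obstacle is that entries on \<open>N\<close> can be as small as 1 / \<rho>, which
  makes a plain count of missing pairs too weak. A missing pair of v in \<open>N\<close> and z in
  \<open>W\<close> is therefore weighted by x v * x z. Summed at z this weight is bounded by the
  loss; summed at v it is large wherever an arc gains, because adjacent vertices share few
  neighbours. The assumption on m makes \<rho> at least 239 r, so an error of 3 r is at most 3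
  \<rho> / 239. The cutoff 12/100 lies just above the positive root, about 0.1185, of X (X - 3/239)
  = 3/239; the later numerical bounds on arcs and loss follow from it.\<close>

lemma compact_unit_cube: "compact (PiE UNIV (\<lambda>_. {0..1}) :: ('a \<Rightarrow> real) set)"
  using compactin_PiE[of "\<lambda>_. euclidean" UNIV "\<lambda>_::'a. {0..1::real}"]
  by (simp add: euclidean_product_topology)

lemma continuous_on_coordinate: "continuous_on S (\<lambda>x :: 'a \<Rightarrow> real. x v)"
  by (rule continuous_on_subset[OF continuous_on_product_coordinates]) simp

lemma nonneg_quadratic_linear_zero:
  fixes b c :: real
  assumes "\<And>t. 2 * t * b + t^2 * c \<ge> 0"
  shows "b = 0"
proof -
  define D where "D = \<bar>c\<bar> + 1"
  have D: "D > 0" "c < D" by (auto simp: D_def)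
  have "0 \<le> 2 * (- b / D) * b + (- b / D)^2 * c" by (rule assms)
  also have "\<dots> = b^2 * (c / D - 2) / D"
    using D by (simp add: field_simps power2_eq_square)
  finally have "0 \<le> b^2 * (c / D - 2)" using D by (simp add: zero_le_divide_iff)
  moreover have "c / D - 2 < 0" using D by (simp add: field_simps)
  ultimately have "b^2 \<le> 0" by (metis zero_le_mult_iff not_less)
  then show ?thesis by simp
qed

section \<open>Quadratic form of a symmetric relation and its maximiser\<close>

locale finite_sym_rel =
  fixes V :: "'a set" and E :: "'a rel"
  assumes finite_V: "finite V"
    and E_subset: "E \<subseteq> V \<times> V"
    and sym_E: "sym E"
begin

lemma E_V: "(v, w) \<in> E \<Longrightarrow> v \<in> V" "(v, w) \<in> E \<Longrightarrow> w \<in> V"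
  using E_subset by auto

lemma E_commute: "(v, w) \<in> E \<longleftrightarrow> (w, v) \<in> E"
  using sym_E by (auto dest: symD)

definition nb :: "'a set \<Rightarrow> 'a \<Rightarrow> 'a set" where
  "nb B v = {w \<in> B. (v, w) \<in> E}"

lemma finite_nb: "finite B \<Longrightarrow> finite (nb B v)"
  by (simp add: nb_def)

lemma sum_nb_swap:
  assumes "finite A" "finite B"
  shows "(\<Sum>v\<in>A. \<Sum>w\<in>nb B v. f v w) = (\<Sum>w\<in>B. \<Sum>v\<in>nb A w. f v w)"
  unfolding nb_def sum.swap_restrict[OF assms] by (simp add: E_commute)

definition form :: "('a \<Rightarrow> real) \<Rightarrow> ('a \<Rightarrow> real) \<Rightarrow> real" where
  "form x y = (\<Sum>v\<in>V. x v * (\<Sum>w\<in>nb V v. y w))"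

lemma form_commute: "form x y = form y x"
  unfolding form_def sum_distrib_left
  by (subst sum_nb_swap[OF finite_V finite_V]) (simp add: mult.commute)

lemma form_add_scaled:
  "form (\<lambda>v. x v + t * y v) (\<lambda>v. x v + t * y v) = form x x + 2 * t * form x y + t^2 * form y y"
proof -
  have "form (\<lambda>v. x v + t * y v) (\<lambda>v. x v + t * y v)
      = form x x + t * form x y + t * form y x + t^2 * form y y"
    unfolding form_def by (simp add: algebra_simps sum.distrib sum_distrib_left power2_eq_square)
  then show ?thesis by (simp add: form_commute[of y x])
qed

lemma form_le_abs: "form x x \<le> form (\<lambda>v. \<bar>x v\<bar>) (\<lambda>v. \<bar>x v\<bar>)"
  unfolding form_def sum_distrib_left
  by (intro sum_mono) (metis abs_ge_self abs_mult)

definition is_eigen :: "real \<Rightarrow> ('a \<Rightarrow> real) \<Rightarrow> bool" where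
  "is_eigen k x \<longleftrightarrow> (\<exists>v\<in>V. x v \<noteq> 0) \<and> (\<forall>v\<in>V. (\<Sum>w\<in>nb V v. x w) = k * x v)"

lemma sum_sq_pos: "(\<exists>v\<in>V. x v \<noteq> 0) \<Longrightarrow> 0 < (\<Sum>v\<in>V. (x v :: real)^2)"
  using finite_V by (auto intro!: sum_pos2)

text \<open>The maximiser of the Rayleigh quotient over nonnegative vectors is a maximiser over all
  vectors, so \<open>\<mu> I - A\<close> is positive semidefinite and the maximiser lies in its kernel.\<close>

lemma ex_nonneg_top_eigenvector:
  assumes "V \<noteq> {}"
  obtains \<mu> x where "is_eigen \<mu> x" "\<And>v. 0 \<le> x v" "\<And>k y. is_eigen k y \<Longrightarrow> k \<le> \<mu>"
proof -
  \<comment> \<open>Vectors are functions on the whole, possibly infinite, type. The cube is compact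
    by Tychonoff, while the form and the normalisation see only the coordinates in
    \<open>V\<close>.\<close>
  define S where "S = PiE UNIV (\<lambda>_. {0..1}) \<inter> {x :: 'a \<Rightarrow> real. (\<Sum>v\<in>V. (x v)^2) = 1}"
  have "closed {x :: 'a \<Rightarrow> real. (\<Sum>v\<in>V. (x v)^2) = 1}"
    by (intro closed_Collect_eq continuous_intros continuous_on_coordinate)
  then have "compact S"
    unfolding S_def by (intro compact_Int_closed compact_unit_cube)
  moreover have "S \<noteq> {}"
  proof -
    obtain u where u: "u \<in> V" using assms by auto
    have "(\<lambda>v. if v = u then 1 else 0) \<in> S"
      using u finite_V by (auto simp: S_def if_distrib[of "\<lambda>z. z^2"] cong: if_cong)
    then show ?thesis by auto
  qed
  moreover have "continuous_on S (\<lambda>x. form x x)"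
    unfolding form_def by (intro continuous_intros continuous_on_coordinate)
  ultimately obtain x where x: "x \<in> S" and max: "\<And>y. y \<in> S \<Longrightarrow> form y y \<le> form x x"
    using continuous_attains_sup[of S "\<lambda>x. form x x"] by blast
  define \<mu> where "\<mu> = form x x"
  have x0: "0 \<le> x v" for v using x by (auto simp: S_def PiE_iff)
  have x1: "(\<Sum>v\<in>V. (x v)^2) = 1" using x by (auto simp: S_def)
  have bound: "form y y \<le> \<mu> * (\<Sum>v\<in>V. (y v)^2)" for y
  proof (cases "\<exists>v\<in>V. y v \<noteq> 0")
    case True
    define n where "n = (\<Sum>v\<in>V. (y v)^2)"
    have n: "0 < n" unfolding n_def by (rule sum_sq_pos[OF True])
    define z where "z v = (if v \<in> V then \<bar>y v\<bar> / sqrt n else 0)" for v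
    have "(z v)^2 \<le> 1" for v
    proof (cases "v \<in> V")
      case v: True
      have "(y v)^2 \<le> n"
        unfolding n_def using v finite_V by (intro member_le_sum) auto
      then show ?thesis using n v by (simp add: z_def power_divide)
    qed (simp add: z_def)
    then have "z v \<le> 1" for v using power2_le_imp_le[of "z v" 1] by simp
    moreover have "0 \<le> z v" for v using n by (simp add: z_def)
    moreover have "(\<Sum>v\<in>V. (z v)^2) = 1"
    proof -
      have "(\<Sum>v\<in>V. (z v)^2) = (\<Sum>v\<in>V. (y v)^2 / n)"
        using n by (intro sum.cong) (auto simp: z_def power_divide)
      also have "\<dots> = 1" using n by (simp add: n_def flip: sum_divide_distrib)
      finally show ?thesis .
    qed
    ultimately have "form z z \<le> \<mu>" unfolding \<mu>_def by (intro max) (auto simp: S_def)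
    also have "form z z = form (\<lambda>v. \<bar>y v\<bar>) (\<lambda>v. \<bar>y v\<bar>) / n"
    proof -
      have "z v * (\<Sum>w\<in>nb V v. z w) = \<bar>y v\<bar> * (\<Sum>w\<in>nb V v. \<bar>y w\<bar>) / n" if "v \<in> V" for v
      proof -
        have "(\<Sum>w\<in>nb V v. z w) = (\<Sum>w\<in>nb V v. \<bar>y w\<bar>) / sqrt n"
          unfolding sum_divide_distrib by (intro sum.cong) (auto simp: z_def nb_def)
        then show ?thesis using that n by (simp add: z_def)
      qed
      then show ?thesis unfolding form_def sum_divide_distrib by (intro sum.cong) auto
    qed
    finally have "form (\<lambda>v. \<bar>y v\<bar>) (\<lambda>v. \<bar>y v\<bar>) \<le> \<mu> * n"
      using n by (simp add: field_simps)
    with form_le_abs[of y] show ?thesis unfolding n_def by linarith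
  qed (auto simp: form_def)
  have eq: "(\<Sum>w\<in>nb V u. x w) = \<mu> * x u" if u: "u \<in> V" for u
  proof -
    \<comment> \<open>First variation in the direction of the coordinate vector of \<open>u\<close>:
      the difference of the two sides of \<open>bound\<close> is nonnegative and vanishes at
      \<open>x\<close>, so its linear coefficient in t is zero.\<close>
    define e where "e v = (if v = u then 1 else 0 :: real)" for v
    have sum_e: "(\<Sum>v\<in>V. e v * f v) = f u" for f
      using u finite_V by (simp add: e_def if_distrib[of "\<lambda>z. z * _"] cong: if_cong)
    have "2 * t * (\<mu> * x u - form x e) + t^2 * (\<mu> - form e e) \<ge> 0" for t
    proof -
      have "form (\<lambda>v. x v + t * e v) (\<lambda>v. x v + t * e v) \<le> \<mu> * (\<Sum>v\<in>V. (x v + t * e v)^2)"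
        by (rule bound)
      also have "(\<Sum>v\<in>V. (x v + t * e v)^2)
          = (\<Sum>v\<in>V. (x v)^2) + 2 * t * (\<Sum>v\<in>V. e v * x v) + t^2 * (\<Sum>v\<in>V. e v * e v)"
        by (simp add: sum_distrib_left power2_eq_square algebra_simps flip: sum.distrib)
      also have "\<dots> = 1 + 2 * t * x u + t^2"
        unfolding x1 sum_e by (simp add: e_def)
      finally show ?thesis
        unfolding form_add_scaled \<mu>_def[symmetric] by (simp add: algebra_simps)
    qed
    then have "form x e = \<mu> * x u" using nonneg_quadratic_linear_zero by fastforce
    moreover have "form x e = (\<Sum>w\<in>nb V u. x w)"
      unfolding form_commute[of x e] form_def[of e x] by (rule sum_e)
    ultimately show ?thesis by simp
  qed
  have "\<exists>v\<in>V. x v \<noteq> 0" using x1 by (rule contrapos_pp) simp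
  with eq have "is_eigen \<mu> x" by (simp add: is_eigen_def)
  moreover have "k \<le> \<mu>" if "is_eigen k y" for k y
  proof -
    have "form y y = k * (\<Sum>v\<in>V. (y v)^2)"
      using that unfolding form_def is_eigen_def
      by (simp add: sum_distrib_left power2_eq_square algebra_simps)
    with bound[of y] have "k * (\<Sum>v\<in>V. (y v)^2) \<le> \<mu> * (\<Sum>v\<in>V. (y v)^2)" by simp
    moreover have "0 < (\<Sum>v\<in>V. (y v)^2)" using that by (intro sum_sq_pos) (simp add: is_eigen_def)
    ultimately show ?thesis by simp
  qed
  ultimately show ?thesis using x0 that by blast
qed

end

section \<open>The deficit identity at a maximal entry\<close>

locale perron = finite_sym_rel +
  fixes x :: "'a \<Rightarrow> real" and \<rho> :: real and u :: 'a
  assumes irrefl_E: "(v, v) \<notin> E"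
    and u_V: "u \<in> V" and x_u: "x u = 1"
    and x_ge_0: "0 \<le> x v"
    and x_le_1: "v \<in> V \<Longrightarrow> x v \<le> 1"
    and eigen: "v \<in> V \<Longrightarrow> (\<Sum>w\<in>nb V v. x w) = \<rho> * x v"
begin

definition N :: "'a set" where "N = nb V u"

definition W :: "'a set" where "W = V - N - {u}"

lemma finite_N: "finite N" and finite_W: "finite W"
  using finite_V by (auto simp: N_def W_def finite_nb)

lemma N_subset: "N \<subseteq> V" and W_subset: "W \<subseteq> V"
  by (auto simp: N_def W_def nb_def)

lemma u_notin: "u \<notin> N" "u \<notin> W"
  by (auto simp: N_def W_def nb_def irrefl_E)

lemma V_eq: "V = insert u (N \<union> W)"
  using u_V N_subset by (auto simp: W_def)

lemma N_W_disjoint: "N \<inter> W = {}"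
  by (auto simp: W_def)

lemma E_u: "(u, v) \<in> E \<longleftrightarrow> v \<in> N"
  using E_V by (auto simp: N_def nb_def)

lemma nb_V_u: "nb V u = N"
  by (simp add: N_def)

lemma nb_V_N: "v \<in> N \<Longrightarrow> nb V v = insert u (nb N v \<union> nb W v)"
  using E_u E_commute[of v u] by (subst (1) V_eq) (auto simp: nb_def)

lemma nb_V_W: "z \<in> W \<Longrightarrow> nb V z = nb N z \<union> nb W z"
  using E_u[of z] E_commute[of z u] N_W_disjoint by (subst (1) V_eq) (auto simp: nb_def)

lemma nb_N_W_disjoint: "nb N v \<inter> nb W v = {}"
  using N_W_disjoint by (auto simp: nb_def)

lemma sum_nb_N: "v \<in> N \<Longrightarrow> (\<Sum>w\<in>nb V v. f w) = f u + (\<Sum>w\<in>nb N v. f w) + (\<Sum>w\<in>nb W v. f w :: real)"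
proof -
  assume "v \<in> N"
  moreover have "u \<notin> nb N v \<union> nb W v" using u_notin by (auto simp: nb_def)
  ultimately show ?thesis
    using finite_N finite_W nb_N_W_disjoint by (simp add: nb_V_N sum.union_disjoint finite_nb)
qed

lemma sum_nb_W: "z \<in> W \<Longrightarrow> (\<Sum>w\<in>nb V z. f w) = (\<Sum>w\<in>nb N z. f w) + (\<Sum>w\<in>nb W z. f w :: real)"
  using finite_N finite_W nb_N_W_disjoint
  by (simp add: nb_V_W sum.union_disjoint finite_nb)

lemma sum_V: "(\<Sum>v\<in>V. f v) = f u + (\<Sum>v\<in>N. f v) + (\<Sum>v\<in>W. f v :: real)"
  using u_notin finite_N finite_W N_W_disjoint
  by (subst V_eq) (simp add: sum.union_disjoint)

lemma eigen_u: "(\<Sum>v\<in>N. x v) = \<rho>"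
  using eigen[OF u_V] by (simp add: nb_V_u x_u)

lemma eigen_N: "v \<in> N \<Longrightarrow> \<rho> * x v = 1 + (\<Sum>w\<in>nb N v. x w) + (\<Sum>w\<in>nb W v. x w)"
  using sum_nb_N[of v x] eigen[of v] N_subset by (auto simp: x_u)

lemma eigen_W: "z \<in> W \<Longrightarrow> \<rho> * x z = (\<Sum>w\<in>nb N z. x w) + (\<Sum>w\<in>nb W z. x w)"
  using sum_nb_W[of z x] eigen[of z] W_subset by auto

definition dN :: "'a \<Rightarrow> real" where "dN v = real (card (nb N v))"

definition dW :: "'a \<Rightarrow> real" where "dW v = real (card (nb W v))"

lemma dN_sum: "dN v = (\<Sum>w\<in>nb N v. 1)" and dW_sum: "dW v = (\<Sum>w\<in>nb W v. 1)"
  by (simp_all add: dN_def dW_def)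

lemma dN_ge_0 [simp]: "0 \<le> dN v" and dW_ge_0 [simp]: "0 \<le> dW v"
  by (simp_all add: dN_def dW_def)

text \<open>Ordered pairs are summed, so each edge inside \<open>N\<close> counts twice, in step
  with \<open>card E\<close> being twice the number of edges.\<close>

definition arc_term :: real where
  "arc_term = (\<Sum>v\<in>N. \<Sum>w\<in>nb N v. 1 - x v - x w)"

text \<open>An edge inside \<open>W\<close> lies on no walk of length two from u and is lost
  entirely, half at each end; an edge from \<open>N\<close> to z recovers only x z of its
  unit.\<close>

definition loss :: "'a \<Rightarrow> real" where
  "loss z = dW z / 2 + dN z * (1 - x z)"

lemma card_E_sum: "real (card E) = (\<Sum>v\<in>V. real (card (nb V v)))"
proof -
  have "E = Sigma V (nb V)" using E_V by (auto simp: nb_def)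
  then have "card E = card (Sigma V (nb V))" by (rule arg_cong)
  then show ?thesis using finite_V by (simp add: finite_nb)
qed

lemma rho_sq: "\<rho>^2 = real (card N) + (\<Sum>v\<in>N. dN v * x v) + (\<Sum>z\<in>W. dN z * x z)"
proof -
  have "\<rho>^2 = (\<Sum>v\<in>N. \<rho> * x v)"
    by (simp add: eigen_u power2_eq_square flip: sum_distrib_left)
  also have "\<dots> = (\<Sum>v\<in>N. 1 + (\<Sum>w\<in>nb N v. x w) + (\<Sum>w\<in>nb W v. x w))"
    by (intro sum.cong) (simp_all add: eigen_N)
  also have "\<dots> = real (card N) + (\<Sum>v\<in>N. \<Sum>w\<in>nb N v. x w) + (\<Sum>v\<in>N. \<Sum>w\<in>nb W v. x w)"
    by (simp add: sum.distrib)
  also have "(\<Sum>v\<in>N. \<Sum>w\<in>nb N v. x w) = (\<Sum>v\<in>N. dN v * x v)"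
    by (subst sum_nb_swap) (simp_all add: finite_N dN_def)
  also have "(\<Sum>v\<in>N. \<Sum>w\<in>nb W v. x w) = (\<Sum>z\<in>W. dN z * x z)"
    by (subst sum_nb_swap) (simp_all add: finite_N finite_W dN_def)
  finally show ?thesis .
qed

text \<open>Arcs at u cancel against the term \<open>card N\<close> of \<open>rho_sq\<close>. Edges
  between \<open>N\<close> and \<open>W\<close> are counted once from each side, and the weight
  inside \<open>N\<close> is split evenly between the two ends of an arc.\<close>

lemma deficit: "real (card E) - 2 * \<rho>^2 = arc_term + 2 * sum loss W"
proof -
  have "real (card E) = real (card N) + (\<Sum>v\<in>N. 1 + dN v + dW v) + (\<Sum>z\<in>W. dN z + dW z)"
  proof -
    have "real (card (nb V v)) = 1 + dN v + dW v" if "v \<in> N" for v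
      using sum_nb_N[OF that, of "\<lambda>_. 1"] by (simp add: dN_def dW_def)
    moreover have "real (card (nb V z)) = dN z + dW z" if "z \<in> W" for z
      using sum_nb_W[OF that, of "\<lambda>_. 1"] by (simp add: dN_def dW_def)
    ultimately show ?thesis
      unfolding card_E_sum sum_V by (simp add: nb_V_u)
  qed
  moreover have "(\<Sum>v\<in>N. dW v) = (\<Sum>z\<in>W. dN z)"
    unfolding dW_sum dN_sum by (rule sum_nb_swap[OF finite_N finite_W])
  moreover have "arc_term = (\<Sum>v\<in>N. dN v) - 2 * (\<Sum>v\<in>N. dN v * x v)"
  proof -
    have "arc_term = (\<Sum>v\<in>N. \<Sum>w\<in>nb N v. 1) - (\<Sum>v\<in>N. \<Sum>w\<in>nb N v. x v) - (\<Sum>v\<in>N. \<Sum>w\<in>nb N v. x w)"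
      unfolding arc_term_def sum_subtractf ..
    also have "(\<Sum>v\<in>N. \<Sum>w\<in>nb N v. x w) = (\<Sum>v\<in>N. dN v * x v)"
      by (subst sum_nb_swap) (simp_all add: finite_N dN_def)
    finally show ?thesis by (simp add: dN_def)
  qed
  moreover have "2 * sum loss W = (\<Sum>z\<in>W. dW z) + 2 * (\<Sum>z\<in>W. dN z) - 2 * (\<Sum>z\<in>W. dN z * x z)"
    unfolding loss_def by (simp add: sum.distrib sum_subtractf sum_distrib_left algebra_simps)
  ultimately show ?thesis
    unfolding rho_sq by (simp add: sum.distrib)
qed

lemma loss_nonneg: "0 \<le> loss z" if "z \<in> W"
  using that x_le_1[of z] W_subset by (auto simp: loss_def)

section \<open>Weight of the missing pairs between \<open>N\<close> and \<open>W\<close>\<close>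

definition D :: "'a \<Rightarrow> real" where "D z = (\<Sum>v\<in>N - nb N z. x v)"

definition R :: "'a \<Rightarrow> real" where "R v = (\<Sum>z\<in>W - nb W v. x z)"

lemma D_ge_0: "0 \<le> D z" and R_ge_0: "0 \<le> R v"
  by (simp_all add: D_def R_def sum_nonneg x_ge_0)

lemma sum_x_nb_le: "(\<Sum>w\<in>nb N v. x w) \<le> dN v" "(\<Sum>w\<in>nb W v. x w) \<le> dW v"
  unfolding dN_sum dW_sum using N_subset W_subset
  by (auto intro!: sum_mono x_le_1 simp del: sum_constant simp: nb_def)

lemma rho_ge_0: "0 \<le> \<rho>"
  using eigen_u sum_nonneg[of N x] x_ge_0 by auto

lemma D_le_rho: "D z \<le> \<rho>"
  unfolding D_def eigen_u[symmetric] using finite_N x_ge_0 by (intro sum_mono2) auto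

lemma D_eq: "(\<Sum>v\<in>nb N z. x v) = \<rho> - D z"
  using sum.subset_diff[of "nb N z" N x] finite_N eigen_u by (auto simp: D_def nb_def)

lemma R_eq: "(\<Sum>z\<in>nb W v. x z) = (\<Sum>z\<in>W. x z) - R v"
  using sum.subset_diff[of "nb W v" W x] finite_W by (auto simp: R_def nb_def)

text \<open>The equation at u says that \<open>N\<close> has total weight \<rho>. Subtracting the
  equation at z leaves the weight that z misses in \<open>N\<close> minus the weight that it sees in
  \<open>W\<close>.\<close>

lemma one_minus_x: "z \<in> W \<Longrightarrow> \<rho> * (1 - x z) = D z - (\<Sum>w\<in>nb W z. x w)"
  using eigen_W[of z] D_eq[of z] by (simp add: algebra_simps)

text \<open>Double counting of missing pairs moves the cost from \<open>W\<close>, where the loss is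
  located, to \<open>N\<close>, where arcs are charged. A general \<open>U\<close> allows vertices
  with neighbours in \<open>W\<close> to be set aside.\<close>

lemma sum_x_D_subset:
  assumes "U \<subseteq> W"
  shows "(\<Sum>z\<in>U. x z * D z) = (\<Sum>v\<in>N. x v * (\<Sum>z\<in>U - nb W v. x z))"
proof -
  have D: "D z = (\<Sum>v | v \<in> N \<and> (v, z) \<notin> E. x v)" for z
    unfolding D_def nb_def by (intro sum.cong) (auto simp: E_commute)
  have R: "(\<Sum>z\<in>U - nb W v. x z) = (\<Sum>z | z \<in> U \<and> (v, z) \<notin> E. x z)" for v
    using assms unfolding nb_def by (intro sum.cong) auto
  have "finite U" using assms finite_W by (rule finite_subset)
  then show ?thesis
    unfolding D R sum_distrib_left
    using sum.swap_restrict[OF _ finite_N, of U "\<lambda>z v. x z * x v" "\<lambda>z v. (v, z) \<notin> E"]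
    by (simp add: mult.commute)
qed

lemma sum_x_D: "(\<Sum>z\<in>W. x z * D z) = (\<Sum>v\<in>N. x v * R v)"
  unfolding R_def by (rule sum_x_D_subset) simp

text \<open>Let B be the weight of the \<open>W\<close>-neighbours of z. If B is at most half of
  \<open>D z\<close>, then 1 - x z is at least D z / (2 \<rho>), and the degree bound dN z + dW z
  \<ge> \<rho> * x z suffices. Otherwise dW z \<ge> B already exceeds D z / 2.\<close>

lemma loss_ge_quarter:
  assumes z: "z \<in> W" and \<rho>: "0 < \<rho>"
  shows "x z * D z / 4 \<le> loss z"
proof -
  define B where "B = (\<Sum>w\<in>nb W z. x w)"
  have B: "B \<le> dW z" unfolding B_def by (rule sum_x_nb_le)
  have x: "0 \<le> x z" "x z \<le> 1" using x_ge_0 x_le_1 z W_subset by auto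
  have eq: "\<rho> * (1 - x z) = D z - B" unfolding B_def by (rule one_minus_x[OF z])
  have deg: "\<rho> * x z \<le> dN z + dW z" using eigen_W[OF z] sum_x_nb_le[of z] by linarith
  have DR: "0 \<le> D z" "D z \<le> \<rho>" by (rule D_ge_0 D_le_rho)+
  show ?thesis
  proof (cases "B \<le> D z / 2")
    case True
    have "\<rho> * (x z * D z / 4) = (\<rho> * x z) * (D z / 4)" by simp
    also have "\<dots> \<le> (dN z + dW z) * (D z / 4)"
      using deg DR by (intro mult_right_mono) auto
    also have "\<dots> \<le> dN z * (D z - B) + dW z * \<rho> / 2"
    proof -
      have "dN z * (D z / 4) \<le> dN z * (D z - B)"
        using True DR by (intro mult_left_mono) auto
      moreover have "dW z * (D z / 4) \<le> dW z * (\<rho> / 2)"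
        using DR by (intro mult_left_mono) auto
      ultimately show ?thesis unfolding distrib_right by simp
    qed
    also have "\<dots> = \<rho> * loss z"
      unfolding eq[symmetric] by (simp add: loss_def algebra_simps)
    finally show ?thesis using \<rho> by simp
  next
    case False
    have "x z * D z \<le> 1 * D z" using x DR by (intro mult_right_mono) auto
    moreover have "0 \<le> dN z * (1 - x z)" using x by simp
    ultimately show ?thesis using False B by (simp add: loss_def)
  qed
qed

text \<open>Without \<open>W\<close>-neighbours, 1 - x z equals D z / \<rho> and \<open>dN z\<close>
  alone is at least \<rho> * x z, so the factor 1/4 disappears.\<close>

lemma loss_ge_isolated:
  assumes z: "z \<in> W" and nb: "nb W z = {}" and \<rho>: "0 < \<rho>"
  shows "x z * D z \<le> loss z"
proof -
  have deg: "\<rho> * x z \<le> dN z" using eigen_W[OF z] sum_x_nb_le[of z] nb by simp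
  have "\<rho> * (x z * D z) \<le> dN z * D z"
    using mult_right_mono[OF deg D_ge_0] by (simp add: algebra_simps)
  also have "\<dots> = \<rho> * loss z"
    using one_minus_x[OF z] nb by (simp add: loss_def dW_def mult.left_commute)
  finally show ?thesis using \<rho> by simp
qed

text \<open>Arcs with a negative term are charged to their smaller end (both ends in case of a tie).\<close>

definition K :: "'a \<Rightarrow> 'a set" where
  "K v = {w \<in> nb N v. x v \<le> x w \<and> 1 < x v + x w}"

definition Q :: "'a set" where "Q = {v \<in> N. K v \<noteq> {}}"

lemma finite_K: "finite (K v)" and finite_Q: "finite Q"
  using finite_N by (simp_all add: K_def Q_def finite_nb)

text \<open>Each unordered pair with a negative term is caught from at least one end, which accounts
  for the factor 2. A tie catches it twice, and nonnegative terms are dropped; both only lower the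
  left side.\<close>

lemma arc_term_ge: "2 * (\<Sum>v\<in>Q. \<Sum>w\<in>K v. 1 - x v - x w) \<le> arc_term"
proof -
  define h where "h v w = (if x v \<le> x w \<and> 1 < x v + x w then 1 - x v - x w else 0)" for v w
  have inner: "(\<Sum>w\<in>nb N v. h v w) = (\<Sum>w\<in>K v. 1 - x v - x w)" for v
    unfolding h_def K_def using finite_N by (simp add: sum.inter_filter finite_nb)
  have "2 * (\<Sum>v\<in>Q. \<Sum>w\<in>K v. 1 - x v - x w) = 2 * (\<Sum>v\<in>N. \<Sum>w\<in>nb N v. h v w)"
    unfolding inner using finite_N by (auto simp: Q_def intro!: sum.mono_neutral_left)
  also have "\<dots> = (\<Sum>v\<in>N. \<Sum>w\<in>nb N v. h v w) + (\<Sum>v\<in>N. \<Sum>w\<in>nb N v. h w v)"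
    using sum_nb_swap[OF finite_N finite_N, of h] by simp
  also have "\<dots> = (\<Sum>v\<in>N. \<Sum>w\<in>nb N v. h v w + h w v)"
    by (simp add: sum.distrib)
  also have "\<dots> \<le> arc_term"
    unfolding arc_term_def by (intro sum_mono) (auto simp: h_def)
  finally show ?thesis .
qed

lemma x_N_ge: "v \<in> N \<Longrightarrow> 1 \<le> \<rho> * x v"
  using eigen_N[of v] x_ge_0 by (simp add: sum_nonneg)

lemma x_N_ge_nb:
  assumes "v \<in> N" "w \<in> nb N v"
  shows "1 + x w \<le> \<rho> * x v"
proof -
  have "x w \<le> (\<Sum>w\<in>nb N v. x w)"
    using assms finite_N x_ge_0 by (intro member_le_sum) (auto simp: finite_nb)
  moreover have "0 \<le> (\<Sum>w\<in>nb W v. x w)" using x_ge_0 by (simp add: sum_nonneg)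
  ultimately show ?thesis using eigen_N[OF assms(1)] by linarith
qed

text \<open>By \<open>rho_sq\<close>, \<rho>^2 is at least \<open>card N\<close>, which is 2 or more
  when v has a neighbour in \<open>N\<close>; a neighbour z of v in \<open>W\<close> adds the
  positive amount dN z * x z to \<open>card N\<close> \<ge> 1.\<close>

lemma rho_gt_1:
  assumes "v \<in> N" and nb: "nb N v \<noteq> {} \<or> nb W v \<noteq> {}"
  shows "1 < \<rho>"
proof -
  have nonneg: "0 \<le> (\<Sum>v\<in>N. dN v * x v)" "0 \<le> (\<Sum>z\<in>W. dN z * x z)"
    using x_ge_0 by (simp_all add: sum_nonneg)
  have "1 < \<rho>^2"
  proof (cases "nb N v = {}")
    case False
    then obtain w where "w \<in> N" "w \<noteq> v" using irrefl_E by (auto simp: nb_def)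
    then have "card {v, w} \<le> card N" using assms(1) finite_N by (intro card_mono) auto
    then show ?thesis using \<open>w \<noteq> v\<close> nonneg unfolding rho_sq by simp
  next
    case True
    then obtain z where z: "z \<in> W" "v \<in> nb N z" using assms E_commute by (auto simp: nb_def)
    have "1 \<le> real (card N)"
      using assms(1) finite_N by (auto simp: Suc_le_eq card_gt_0_iff)
    moreover have "0 < dN z" using z finite_N by (auto simp: dN_def finite_nb card_gt_0_iff)
    moreover have "0 < x z"
    proof -
      have "x v \<le> (\<Sum>w\<in>nb N z. x w)"
        using z finite_N x_ge_0 by (intro member_le_sum) (auto simp: finite_nb)
      moreover have "0 \<le> (\<Sum>w\<in>nb W z. x w)" using x_ge_0 by (simp add: sum_nonneg)
      moreover have "x v \<noteq> 0" using x_N_ge[OF assms(1)] by auto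
      ultimately have "0 < \<rho> * x z" using eigen_W[OF z(1)] x_ge_0[of v] by linarith
      then show ?thesis using x_ge_0[of z] by (auto simp: zero_less_mult_iff)
    qed
    then have "0 < dN z * x z" using \<open>0 < dN z\<close> by (rule mult_pos_pos[rotated])
    ultimately have "1 < real (card N) + dN z * x z" by linarith
    moreover have "dN z * x z \<le> (\<Sum>z\<in>W. dN z * x z)"
      using z finite_W x_ge_0 by (intro member_le_sum) auto
    ultimately show ?thesis using nonneg unfolding rho_sq by linarith
  qed
  then show ?thesis using rho_ge_0 power_le_one[of \<rho> 2] by force
qed

end

section \<open>Consequences of bounded codegree\<close>

locale book_free_perron = perron +
  fixes r :: nat
  assumes codegree_le: "(v, w) \<in> E \<Longrightarrow> card (nb V v \<inter> nb V w) \<le> r"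
    and r_ge_1: "1 \<le> r"
    and rho_ge: "239 * real r \<le> \<rho>"
begin

lemma rho_pos: "0 < \<rho>"
  using r_ge_1 rho_ge by simp

lemma card_nb_N_le: "v \<in> N \<Longrightarrow> card (nb N v) \<le> r"
proof -
  assume "v \<in> N"
  then have "card (nb V u \<inter> nb V v) \<le> r" by (intro codegree_le) (simp add: E_u)
  moreover have "nb V u \<inter> nb V v = nb N v" using N_subset unfolding nb_V_u by (auto simp: nb_def)
  ultimately show ?thesis by simp
qed

text \<open>The neighbours of w weigh 1 at u, at most r inside \<open>N\<close>, and at most r - 1
  among those in \<open>W\<close> shared with v, since u is itself one of the r common neighbours.
  Whatever remains is missed by v.\<close>

lemma R_ge:
  assumes v: "v \<in> N" and w: "w \<in> nb N v"
  shows "\<rho> * x w \<le> R v + 2 * real r"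
proof -
  have wN: "w \<in> N" and vw: "(v, w) \<in> E" using w by (auto simp: nb_def)
  have fin: "finite (nb W w \<inter> nb W v)" using finite_W by (simp add: finite_nb)
  have "card (insert u (nb W w \<inter> nb W v)) \<le> card (nb V v \<inter> nb V w)"
    using v wN W_subset finite_V u_V E_u E_commute
    by (intro card_mono) (auto simp: nb_def)
  also have "\<dots> \<le> r" by (rule codegree_le[OF vw])
  finally have common: "real (card (nb W w \<inter> nb W v)) + 1 \<le> real r"
    using fin u_notin by (simp add: nb_def)
  have "(\<Sum>z\<in>nb W w. x z) = (\<Sum>z\<in>nb W w \<inter> nb W v. x z) + (\<Sum>z\<in>nb W w - nb W v. x z)"
    using finite_W by (intro sum.Int_Diff) (simp add: finite_nb)
  moreover have "(\<Sum>z\<in>nb W w \<inter> nb W v. x z) \<le> (\<Sum>z\<in>nb W w \<inter> nb W v. 1)"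
    using W_subset by (intro sum_mono x_le_1) (auto simp: nb_def)
  moreover have "(\<Sum>z\<in>nb W w - nb W v. x z) \<le> R v"
    unfolding R_def using finite_W x_ge_0 by (intro sum_mono2) (auto simp: nb_def)
  moreover have "(\<Sum>y\<in>nb N w. x y) \<le> real r"
    using sum_x_nb_le(1)[of w] card_nb_N_le[OF wN] by (simp add: dN_def)
  ultimately show ?thesis using eigen_N[OF wN] common by simp
qed

text \<open>With X = x w and Y = x v, \<open>R_ge\<close> and the bounds on k give at least Y
  (\<rho> X - 3 r) + 1 - X. Since r \<le> \<rho> / 239 and \<rho> Y \<ge> 1 + X, this is at least 1
  - 3/239 + X (X - 3/239), which exceeds 1 from X = 12/100 on.\<close>

lemma arc_gain:
  assumes v: "v \<in> N" and w: "w \<in> nb N v" and xw: "12 / 100 \<le> x w"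
    and k: "1 \<le> k" "k \<le> real r"
  shows "1 < x v * R v + k * (1 - x v - x w)"
proof -
  define X where "X = x w"
  define Y where "Y = x v"
  have X: "12 / 100 \<le> X" "X \<le> 1" using xw w x_le_1 N_subset by (auto simp: X_def nb_def)
  have Y: "0 \<le> Y" "1 + X \<le> \<rho> * Y" using x_ge_0 x_N_ge_nb[OF v w] by (auto simp: X_def Y_def)
  have "1 * (1 - X) \<le> k * (1 - X)" using k X by (intro mult_right_mono) auto
  moreover have "k * Y \<le> real r * Y" using k Y by (intro mult_right_mono) auto
  moreover have "Y * (\<rho> * X - 2 * real r) \<le> Y * R v"
    using R_ge[OF v w] Y by (intro mult_left_mono) (auto simp: X_def)
  moreover have "(1 + X) * (X - 3 / 239) \<le> (\<rho> * Y) * (X - 3 / 239)"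
    using X Y by (intro mult_right_mono) auto
  moreover have "Y * (239 * real r) \<le> Y * \<rho>" using rho_ge Y by (intro mult_left_mono)
  moreover have "12 / 100 * (12 / 100 - 3 / 239) \<le> X * (X - 3 / 239)"
    using X by (intro mult_mono) auto
  ultimately have "1 < Y * R v + k * (1 - Y - X)"
    unfolding distrib_left distrib_right left_diff_distrib right_diff_distrib mult_1 mult_1_right
    by (simp only: mult.commute mult.left_commute)
  then show ?thesis by (simp add: X_def Y_def)
qed

text \<open>The larger end w of a charged arc has x w > 1/2, so \<open>R_ge\<close> yields R v \<ge>
  239 r / 2 - 2 r.\<close>

lemma Q_D:
  assumes "v \<in> Q"
  shows "v \<in> N" "1 \<le> real (card (K v))" "real (card (K v)) \<le> real r" "117 * real r \<le> R v"
proof -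
  show v: "v \<in> N" using assms by (simp add: Q_def)
  show "1 \<le> real (card (K v))"
    using assms finite_K[of v] by (simp add: Q_def Suc_le_eq card_gt_0_iff)
  have "card (K v) \<le> card (nb N v)"
    using finite_N by (intro card_mono) (auto simp: K_def finite_nb)
  then show "real (card (K v)) \<le> real r" using card_nb_N_le[OF v] by simp
  obtain w where w: "w \<in> nb N v" "x v \<le> x w" "1 < x v + x w"
    using assms by (auto simp: Q_def K_def)
  then have "1 / 2 \<le> x w" by simp
  then have "\<rho> * (1 / 2) \<le> \<rho> * x w" using rho_pos by (intro mult_left_mono) auto
  then show "117 * real r \<le> R v" using R_ge[OF v w(1)] rho_ge by linarith
qed

lemma Q_arcs_ge:
  assumes "v \<in> Q"
  shows "- real r * x v \<le> (\<Sum>w\<in>K v. 1 - x v - x w)"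
proof -
  have "(\<Sum>w\<in>K v. - x v) \<le> (\<Sum>w\<in>K v. 1 - x v - x w)"
    using x_le_1 N_subset by (intro sum_mono) (auto simp: K_def nb_def)
  moreover have "real (card (K v)) * x v \<le> real r * x v"
    using Q_D(3)[OF assms] x_ge_0 by (intro mult_right_mono)
  ultimately show ?thesis by simp
qed

text \<open>Two demands compete for the loss: the 2 to be reached and the 2 r q that the arcs may
  gain. Many arcs inside \<open>W\<close> allow the crude bound with factor 1/4; with few of them,
  their ends are separated from the rest of \<open>W\<close>, so that no loss is used twice.\<close>

lemma W_arc_deficit:
  assumes z: "z \<in> W" and nb: "nb W z \<noteq> {}"
  shows "2 \<le> arc_term + 2 * sum loss W"
proof -
  define L where "L = sum loss W"
  define a where "a = (\<Sum>z\<in>W. dW z)"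
  define q where "q = (\<Sum>v\<in>Q. x v)"
  have QN: "Q \<subseteq> N" by (auto simp: Q_def)
  have q: "0 \<le> q" using x_ge_0 by (simp add: q_def sum_nonneg)
  have arcs: "- 2 * real r * q \<le> arc_term"
  proof -
    have "- real r * q \<le> (\<Sum>v\<in>Q. \<Sum>w\<in>K v. 1 - x v - x w)"
      unfolding q_def sum_distrib_left by (intro sum_mono Q_arcs_ge)
    then show ?thesis using arc_term_ge by linarith
  qed
  have La: "a / 2 \<le> L"
    unfolding a_def L_def sum_divide_distrib using x_le_1 W_subset
    by (intro sum_mono) (auto simp: loss_def)
  have Rq: "117 * real r * q \<le> (\<Sum>v\<in>N. x v * R v)"
  proof -
    have "117 * real r * q \<le> (\<Sum>v\<in>Q. x v * R v)"
      unfolding q_def sum_distrib_left using Q_D(4) x_ge_0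
      by (intro sum_mono) (simp add: mult.commute mult_left_mono)
    also have "\<dots> \<le> (\<Sum>v\<in>N. x v * R v)"
      using QN finite_N x_ge_0 R_ge_0 by (intro sum_mono2) auto
    finally show ?thesis .
  qed
  have a2: "2 \<le> a"
  proof -
    obtain z' where z': "z' \<in> W" "(z, z') \<in> E" using nb by (auto simp: nb_def)
    have "z \<noteq> z'" using z' irrefl_E by auto
    have "1 \<le> dW z" "1 \<le> dW z'"
      using z z' nb finite_W E_commute by (auto simp: dW_def nb_def Suc_le_eq card_gt_0_iff)
    then have "2 \<le> (\<Sum>y\<in>{z, z'}. dW y)" using \<open>z \<noteq> z'\<close> by simp
    also have "\<dots> \<le> a" unfolding a_def using z z' finite_W by (intro sum_mono2) auto
    finally show ?thesis .
  qed
  show ?thesis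
  proof (cases "4 \<le> a")
    case True
    \<comment> \<open>Of the two copies of \<open>L\<close> in the deficit, one is at least a / 2
      \<ge> 2 and the other at least 117 r q / 4, which covers the arcs.\<close>
    have "(\<Sum>z\<in>W. x z * D z) / 4 \<le> L"
      unfolding L_def sum_divide_distrib using loss_ge_quarter rho_pos by (intro sum_mono)
    with Rq have "117 * real r * q / 4 \<le> L" unfolding sum_x_D by linarith
    moreover have "0 \<le> real r * q" using q by simp
    ultimately show ?thesis using True La arcs unfolding L_def by linarith
  next
    case False
    define W1 where "W1 = {z \<in> W. nb W z \<noteq> {}}"
    have W1: "W1 \<subseteq> W" "finite W1" using finite_W by (auto simp: W1_def)
    have dW1: "1 \<le> dW z" if "z \<in> W1" for z
      using that finite_W by (auto simp: W1_def dW_def finite_nb Suc_le_eq card_gt_0_iff)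
    have aW1: "a = (\<Sum>z\<in>W1. dW z)"
      unfolding a_def using finite_W by (intro sum.mono_neutral_right) (auto simp: W1_def dW_def)
    have "real (card W1) \<le> a" using sum_mono[of W1 "\<lambda>_. 1" dW] dW1 by (simp add: aW1)
    then have cW1: "real (card W1) \<le> 4" using False by simp
    have "a / 2 + (\<Sum>z\<in>W - W1. x z * D z) \<le> L"
    proof -
      have "L = (\<Sum>z\<in>W1. loss z) + (\<Sum>z\<in>W - W1. loss z)"
        unfolding L_def using W1 finite_W sum.subset_diff[of W1 W loss] by simp
      moreover have "a / 2 \<le> (\<Sum>z\<in>W1. loss z)"
        unfolding aW1 sum_divide_distrib using x_le_1 W_subset W1
        by (intro sum_mono) (auto simp: loss_def)
      moreover have "(\<Sum>z\<in>W - W1. x z * D z) \<le> (\<Sum>z\<in>W - W1. loss z)"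
        using rho_pos by (intro sum_mono loss_ge_isolated) (auto simp: W1_def)
      ultimately show ?thesis by linarith
    qed
    moreover have "113 * real r * q \<le> (\<Sum>z\<in>W - W1. x z * D z)"
    proof -
      have "113 * real r * q = (\<Sum>v\<in>Q. 113 * real r * x v)"
        unfolding q_def by (rule sum_distrib_left)
      also have "\<dots> \<le> (\<Sum>v\<in>Q. x v * (\<Sum>z\<in>W - W1 - nb W v. x z))"
      proof (intro sum_mono)
        fix v assume v: "v \<in> Q"
        have "R v \<le> (\<Sum>z\<in>(W - W1 - nb W v) \<union> W1. x z)"
          unfolding R_def using finite_W W1 x_ge_0 by (intro sum_mono2) auto
        also have "\<dots> = (\<Sum>z\<in>W - W1 - nb W v. x z) + (\<Sum>z\<in>W1. x z)"
          using finite_W W1 by (intro sum.union_disjoint) auto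
        also have "(\<Sum>z\<in>W1. x z) \<le> (\<Sum>z\<in>W1. 1)"
          using W1 W_subset by (intro sum_mono x_le_1) auto
        \<comment> \<open>Removing \<open>W1\<close> costs at most its cardinality, hence at most 4
          \<le> 4 r of the 117 r.\<close>
        finally have "113 * real r \<le> (\<Sum>z\<in>W - W1 - nb W v. x z)"
          using cW1 Q_D(4)[OF v] r_ge_1 by simp
        then show "113 * real r * x v \<le> x v * (\<Sum>z\<in>W - W1 - nb W v. x z)"
          using x_ge_0 by (simp add: mult.commute mult_left_mono)
      qed
      also have "\<dots> \<le> (\<Sum>z\<in>W - W1. x z * D z)"
        unfolding sum_x_D_subset[of "W - W1", OF Diff_subset] using QN finite_N x_ge_0
        by (intro sum_mono2) (auto intro!: mult_nonneg_nonneg sum_nonneg)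
      finally show ?thesis .
    qed
    moreover have "0 \<le> real r * q" using q by simp
    ultimately show ?thesis using a2 arcs unfolding L_def by linarith
  qed
qed


text \<open>For independent \<open>W\<close> the loss covers all missing pairs at full weight, so
  every vertex of \<open>Q\<close> has its own balance, and each balance is at least 1.\<close>

lemma Q_deficit:
  assumes iso: "\<And>z. z \<in> W \<Longrightarrow> nb W z = {}" and Q: "Q \<noteq> {}"
  shows "2 \<le> arc_term + 2 * sum loss W"
proof -
  have per_vertex: "1 \<le> x v * R v + (\<Sum>w\<in>K v. 1 - x v - x w)" if v: "v \<in> Q" for v
  proof -
    \<comment> \<open>The heaviest charged neighbour gives the most negative term, so it may stand
      in for all of \<open>K v\<close> with k = card (K v).\<close>
    have "finite (x ` K v)" "x ` K v \<noteq> {}" using v finite_K by (auto simp: Q_def)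
    then have "Max (x ` K v) \<in> x ` K v" by (rule Max_in)
    then obtain w where "w \<in> K v" "x w = Max (x ` K v)" by auto
    then have w: "w \<in> K v" "\<And>y. y \<in> K v \<Longrightarrow> x y \<le> x w"
      using finite_K by simp_all
    have "1 < x v * R v + real (card (K v)) * (1 - x v - x w)"
      using Q_D[OF v] w by (intro arc_gain) (auto simp: K_def)
    also have "real (card (K v)) * (1 - x v - x w) = (\<Sum>y\<in>K v. 1 - x v - x w)" by simp
    also have "\<dots> \<le> (\<Sum>y\<in>K v. 1 - x v - x y)" using w(2) by (intro sum_mono) auto
    finally show ?thesis by simp
  qed
  have QN: "Q \<subseteq> N" by (auto simp: Q_def)
  have "1 \<le> real (card Q)" using Q finite_Q by (simp add: Suc_le_eq card_gt_0_iff)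
  also have "real (card Q) = (\<Sum>v\<in>Q. 1)" by simp
  also have "\<dots> \<le> (\<Sum>v\<in>Q. x v * R v) + (\<Sum>v\<in>Q. \<Sum>w\<in>K v. 1 - x v - x w)"
    unfolding sum.distrib[symmetric] by (intro sum_mono per_vertex)
  also have "(\<Sum>v\<in>Q. x v * R v) \<le> (\<Sum>v\<in>N. x v * R v)"
    using QN finite_N x_ge_0 R_ge_0 by (intro sum_mono2) auto
  also have "\<dots> \<le> sum loss W"
    unfolding sum_x_D[symmetric] using iso rho_pos by (intro sum_mono loss_ge_isolated) auto
  finally show ?thesis using arc_term_ge by linarith
qed

section \<open>Structure when the doubled deficit is below 2\<close>

text \<open>\<open>Q\<close> is empty, so all arc terms are nonnegative and the two arcs between v
  and w can be kept alone. If x v reached the cutoff, \<open>arc_gain\<close> with the roles of v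
  and w exchanged and k = 1 would push the deficit past 2.\<close>

lemma arc_in_N_x_small:
  assumes iso: "\<And>z. z \<in> W \<Longrightarrow> nb W z = {}"
    and small: "arc_term + 2 * sum loss W < 2"
    and v: "v \<in> N" and w: "w \<in> nb N v"
  shows "x v < 12 / 100"
proof (rule ccontr)
  assume xv: "\<not> x v < 12 / 100"
  have wN: "w \<in> N" and vw: "v \<in> nb N w" "v \<noteq> w"
    using v w E_commute irrefl_E by (auto simp: nb_def)
  have Q: "Q = {}" using Q_deficit[OF iso] small by auto
  have nonneg: "0 \<le> 1 - x a - x b" if "a \<in> N" "b \<in> nb N a" for a b
  proof (rule ccontr)
    assume "\<not> 0 \<le> 1 - x a - x b"
    then have "b \<in> K a \<or> a \<in> K b"
      using that E_commute[of a b] by (auto simp: K_def nb_def)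
    moreover have "b \<in> N" using that by (simp add: nb_def)
    ultimately show False using Q that(1) by (auto simp: Q_def)
  qed
  have "2 * (1 - x v - x w) \<le> arc_term"
  proof -
    have part: "1 - x a - x b \<le> (\<Sum>y\<in>nb N a. 1 - x a - x y)" if "a \<in> N" "b \<in> nb N a" for a b
      using nonneg that finite_N by (intro member_le_sum[of b]) (auto simp: finite_nb)
    have "2 * (1 - x v - x w) \<le> (\<Sum>a\<in>{v, w}. \<Sum>b\<in>nb N a. 1 - x a - x b)"
      using part[OF v w] part[OF wN vw(1)] vw(2) by simp
    also have "\<dots> \<le> arc_term"
      unfolding arc_term_def using v wN finite_N nonneg by (intro sum_mono2 sum_nonneg) auto
    finally show ?thesis .
  qed
  moreover have "x w * R w \<le> sum loss W"
  proof -
    have "x w * R w \<le> (\<Sum>v\<in>N. x v * R v)"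
      using wN finite_N x_ge_0 R_ge_0 by (intro member_le_sum) auto
    also have "\<dots> \<le> sum loss W"
      unfolding sum_x_D[symmetric] using iso rho_pos by (intro sum_mono loss_ge_isolated) auto
    finally show ?thesis .
  qed
  moreover have "1 < x w * R w + 1 * (1 - x w - x v)"
    using xv r_ge_1 by (intro arc_gain[OF wN vw(1)]) auto
  ultimately show False using small by argo
qed

text \<open>Each arc contributes at least 76/100 = 1 - 2 * 12/100, and three of them would exceed
  2.\<close>

lemma N_arcs_unique:
  assumes iso: "\<And>z. z \<in> W \<Longrightarrow> nb W z = {}"
    and small: "arc_term + 2 * sum loss W < 2"
  shows "card (Sigma N (nb N)) \<le> 2"
proof -
  have "real (card (Sigma N (nb N))) * (76 / 100) = (\<Sum>v\<in>N. \<Sum>w\<in>nb N v. 76 / 100)"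
    using finite_N by (simp add: finite_nb sum_divide_distrib sum_distrib_right)
  also have "\<dots> \<le> arc_term"
    unfolding arc_term_def
  proof (intro sum_mono)
    fix v w assume v: "v \<in> N" and w: "w \<in> nb N v"
    then have "w \<in> N" "v \<in> nb N w" using E_commute by (auto simp: nb_def)
    then show "76 / 100 \<le> 1 - x v - x w"
      using arc_in_N_x_small[OF iso small v w] arc_in_N_x_small[OF iso small, of w v] by simp
  qed
  also have "\<dots> < 2" using small sum_nonneg[of W loss] loss_nonneg by force
  finally have "real (card (Sigma N (nb N))) < 3" by simp
  then show ?thesis by simp
qed

lemma N_arcs_eq:
  assumes iso: "\<And>z. z \<in> W \<Longrightarrow> nb W z = {}"
    and small: "arc_term + 2 * sum loss W < 2"
    and arc: "a \<in> N" "b \<in> nb N a"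
  shows "Sigma N (nb N) = {(a, b), (b, a)}"
proof -
  have bN: "b \<in> N" and ba: "a \<in> nb N b" "a \<noteq> b"
    using arc E_commute irrefl_E by (auto simp: nb_def)
  show ?thesis
  proof (rule card_seteq[symmetric])
    show "finite (Sigma N (nb N))" using finite_N by (simp add: finite_nb)
    show "{(a, b), (b, a)} \<subseteq> Sigma N (nb N)" using arc bN ba by simp
    show "card (Sigma N (nb N)) \<le> card {(a, b), (b, a)}"
      using N_arcs_unique[OF iso small] ba(2) by simp
  qed
qed

text \<open>Summing the loss over all \<open>z\<close> not adjacent to \<open>v\<close> instead of a single one is essential: \<open>v\<close> may
  have an entry as small as \<open>1 / \<rho>\<close>, but then it misses almost all of the weight \<open>X\<close>.\<close>

lemma W_N_complete:
  assumes iso: "\<And>z. z \<in> W \<Longrightarrow> nb W z = {}"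
    and small: "arc_term + 2 * sum loss W < 2"
    and arc: "a \<in> N" "b \<in> nb N a"
    and no_isolated: "\<And>z. z \<in> W \<Longrightarrow> nb N z \<noteq> {}"
    and z: "z \<in> W" and v: "v \<in> N"
  shows "(z, v) \<in> E"
proof (rule ccontr)
  assume nonadj: "(z, v) \<notin> E"
  have bN: "b \<in> N" and ba: "a \<in> nb N b" "a \<noteq> b"
    using arc E_commute irrefl_E by (auto simp: nb_def)
  have arcs_eq: "Sigma N (nb N) = {(a, b), (b, a)}"
    by (rule N_arcs_eq[OF iso small arc])
  have sing: "nb N y \<subseteq> {if y = a then b else a}" if "y \<in> N" for y
  proof
    fix w assume "w \<in> nb N y"
    then have "(y, w) \<in> Sigma N (nb N)" using that by simp
    then show "w \<in> {if y = a then b else a}" unfolding arcs_eq using ba(2) by auto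
  qed
  have small_x: "x a < 12 / 100" "x b < 12 / 100"
    using arc_in_N_x_small[OF iso small] arc bN ba by auto
  have "2 * (1 - x a - x b) = arc_term"
  proof -
    have "arc_term = (\<Sum>(v, w)\<in>Sigma N (nb N). 1 - x v - x w)"
      unfolding arc_term_def using finite_N by (intro sum.Sigma) (auto simp: finite_nb)
    also have "\<dots> = 2 * (1 - x a - x b)" using ba unfolding arcs_eq by simp
    finally show ?thesis by simp
  qed
  \<comment> \<open>The single edge already uses more than 2 * 76/100 of the available 2.\<close>
  with small small_x have loss_small: "sum loss W < 24 / 100" by argo
  have loss_le: "loss z \<le> sum loss W"
    using z finite_W loss_nonneg by (intro member_le_sum) auto
  have xz: "1 / 2 \<le> x z"
  proof (rule ccontr)
    assume "\<not> 1 / 2 \<le> x z"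
    moreover have "1 \<le> dN z"
      using no_isolated[OF z] finite_N by (simp add: dN_def finite_nb Suc_le_eq card_gt_0_iff)
    then have "1 * (1 - x z) \<le> dN z * (1 - x z)"
      using x_le_1 z W_subset by (intro mult_right_mono) auto
    ultimately have "1 / 2 \<le> loss z" unfolding loss_def using dW_ge_0[of z] by argo
    then show False using loss_le loss_small by simp
  qed
  \<comment> \<open>The total weight of u and \<open>W\<close>: up to its at most one neighbour
    inside \<open>N\<close>, a vertex of \<open>N\<close> sees no more than this.\<close>
  define X where "X = 1 + (\<Sum>z\<in>W. x z)"
  have X: "3 / 2 \<le> X"
    using xz member_le_sum[of z W x] z finite_W x_ge_0 by (simp add: X_def)
  have x_N_le: "\<rho> * x y \<le> X + 12 / 100" if y: "y \<in> N" for y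
  proof -
    have "(\<Sum>w\<in>nb N y. x w) \<le> (\<Sum>w\<in>{if y = a then b else a}. x w)"
      using sing[OF y] x_ge_0 by (intro sum_mono2) auto
    then have "(\<Sum>w\<in>nb N y. x w) \<le> 12 / 100" using small_x by (auto split: if_splits)
    moreover have "(\<Sum>w\<in>nb W y. x w) \<le> X - 1"
      unfolding X_def using finite_W x_ge_0 by (auto simp: nb_def intro!: sum_mono2)
    ultimately show ?thesis using eigen_N[OF y] by linarith
  qed
  \<comment> \<open>Entries on \<open>N\<close> are at most (X + 12/100) / \<rho>, so y needs
    correspondingly many neighbours there. This improves \<open>loss_ge_isolated\<close>, which
    bounds those entries only by 1.\<close>
  have loss_ge: "\<rho> * (x y * D y) / (X + 12 / 100) \<le> loss y" if y: "y \<in> W" for y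
  proof -
    have "\<rho> * (\<rho> * x y) = (\<Sum>v\<in>nb N y. \<rho> * x v)"
      using eigen_W[OF y] iso[OF y] by (simp add: sum_distrib_left)
    also have "\<dots> \<le> (\<Sum>v\<in>nb N y. X + 12 / 100)"
      by (intro sum_mono x_N_le) (auto simp: nb_def)
    finally have "\<rho> * (\<rho> * x y) \<le> dN y * (X + 12 / 100)" by (simp add: dN_def)
    then have "\<rho> * (\<rho> * x y) * D y \<le> dN y * (X + 12 / 100) * D y"
      by (intro mult_right_mono D_ge_0)
    also have "\<dots> = (X + 12 / 100) * (\<rho> * loss y)"
      using one_minus_x[OF y] iso[OF y] by (simp add: loss_def dW_def mult.left_commute mult.commute)
    finally have "\<rho> * (\<rho> * (x y * D y)) \<le> \<rho> * ((X + 12 / 100) * loss y)"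
      by (simp add: mult.left_commute mult.commute)
    then have "\<rho> * (x y * D y) \<le> (X + 12 / 100) * loss y" using rho_pos by simp
    then show ?thesis using X by (simp add: field_simps)
  qed
  have R_v: "1 / 2 \<le> R v"
  proof -
    have "x z \<le> R v"
      unfolding R_def using z nonadj finite_W x_ge_0 E_commute[of v z]
      by (intro member_le_sum) (auto simp: nb_def)
    then show ?thesis using xz by simp
  qed
  \<comment> \<open>The weight of the neighbours of v in \<open>insert u W\<close>, a lower bound
    for \<rho> * x v.\<close>
  define q where "q = X - R v"
  have q: "1 \<le> q" "q \<le> \<rho> * x v"
  proof -
    have "(\<Sum>w\<in>nb W v. x w) = q - 1" by (simp add: R_eq q_def X_def)
    moreover have "0 \<le> (\<Sum>w\<in>nb W v. x w)" "0 \<le> (\<Sum>w\<in>nb N v. x w)"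
      using x_ge_0 by (simp_all add: sum_nonneg)
    ultimately show "1 \<le> q" "q \<le> \<rho> * x v" using eigen_N[OF v] by linarith+
  qed
  have "q * R v \<le> \<rho> * (x v * R v)"
    using mult_right_mono[OF q(2) R_ge_0[of v]] by (simp add: mult.assoc)
  also have "\<dots> \<le> \<rho> * (\<Sum>v\<in>N. x v * R v)"
    using rho_pos v finite_N x_ge_0 R_ge_0 by (intro mult_left_mono member_le_sum) auto
  also have "\<dots> = (\<Sum>y\<in>W. \<rho> * (x y * D y))"
    unfolding sum_x_D[symmetric] by (simp add: sum_distrib_left)
  finally have "q * R v / (X + 12 / 100) \<le> (\<Sum>y\<in>W. \<rho> * (x y * D y)) / (X + 12 / 100)"
    using X by (intro divide_right_mono) auto
  also have "\<dots> \<le> sum loss W"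
    unfolding sum_divide_distrib by (intro sum_mono loss_ge)
  also note loss_small
  finally have "q * R v / (X + 12 / 100) < 24 / 100" .
  then have "q * R v < 24 / 100 * (X + 12 / 100)" using X by (simp add: pos_divide_less_eq)
  \<comment> \<open>As q and \<open>R v\<close> add up to \<open>X\<close> and are bounded below by
    1 and 1/2, their product is at least X/2 - 1/4. For X \<ge> 3/2 this exceeds 24/100 * (X +
    12/100).\<close>
  moreover have "0 \<le> (q - 1) * (R v - 1 / 2)" using q R_v by (intro mult_nonneg_nonneg) auto
  then have "q / 2 + R v - 1 / 2 \<le> q * R v" by (simp add: field_simps)
  moreover have "q = X - R v" by (rule q_def)
  ultimately show False using X R_v by argo
qed

end

section \<open>Adjacency matrices, books and isomorphisms\<close>

lemma pair_graph_finite_sym_rel: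
  assumes "pair_graph G"
  shows "finite_sym_rel (pverts G) (parcs G)"
proof -
  interpret pair_graph G by fact
  show ?thesis
  proof (rule finite_sym_rel.intro)
    show "finite (pverts G)" by (rule pair_finite_verts)
    show "parcs G \<subseteq> pverts G \<times> pverts G" by (auto dest: in_arcsD1 in_arcsD2)
    show "sym (parcs G)" by (rule symI) (rule arcs_symmetric)
  qed
qed

lemma card_sym_irrefl_rel:
  assumes fin: "finite E" and sym: "sym E" and irr: "\<And>v. (v, v) \<notin> E"
  shows "card E = 2 * card ((\<lambda>(u, v). {u, v}) ` E)"
proof -
  let ?f = "\<lambda>(u, v). {u, v}"
  have "card E = (\<Sum>e\<in>?f ` E. card {a \<in> E. ?f a = e})"
    using sum.image_gen[OF fin, of "\<lambda>_. 1 :: nat" ?f] by simp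
  also have "\<dots> = (\<Sum>e\<in>?f ` E. 2)"
  proof (rule sum.cong[OF refl])
    fix e assume "e \<in> ?f ` E"
    then obtain u v where e: "e = {u, v}" and uv: "(u, v) \<in> E" by auto
    have "(v, u) \<in> E" using sym uv by (rule symD)
    have "(a \<in> E \<and> ?f a = e) \<longleftrightarrow> a = (u, v) \<or> a = (v, u)" for a
    proof (cases a)
      case (Pair x y)
      have "?f a = e \<longleftrightarrow> a = (u, v) \<or> a = (v, u)"
        by (simp add: Pair e doubleton_eq_iff)
      then show ?thesis using uv \<open>(v, u) \<in> E\<close> by blast
    qed
    then have "{a \<in> E. ?f a = e} = {(u, v), (v, u)}"
      by (simp only: set_eq_iff mem_Collect_eq insert_iff empty_iff simp_thms)
    moreover have "u \<noteq> v" using uv irr by auto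
    ultimately show "card {a \<in> E. ?f a = e} = 2" by simp
  qed
  finally show ?thesis by simp
qed

lemma card_parcs:
  assumes "pair_graph G"
  shows "card (parcs G) = 2 * card (edges G)"
proof -
  interpret pair_graph G by fact
  interpret finite_sym_rel "pverts G" "parcs G" by (rule pair_graph_finite_sym_rel) fact
  show ?thesis
    unfolding edges_def
    by (rule card_sym_irrefl_rel[OF pair_finite_arcs sym_E]) (use no_loops' in blast)
qed

lemma adjacency_mat_mult_vec:
  assumes "pair_graph G" "distinct vs" "set vs = pverts G"
  defines "n \<equiv> length vs"
  shows "adjacency_mat G vs *\<^sub>v vec n (\<lambda>i. x (vs ! i))
    = vec n (\<lambda>i. \<Sum>w\<in>finite_sym_rel.nb (parcs G) (pverts G) (vs ! i). x w)"
proof (rule eq_vecI)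
  interpret finite_sym_rel "pverts G" "parcs G" by (rule pair_graph_finite_sym_rel) fact
  fix i assume i: "i < dim_vec (vec n (\<lambda>i. \<Sum>w\<in>nb (pverts G) (vs ! i). x w))"
  have "(adjacency_mat G vs *\<^sub>v vec n (\<lambda>i. x (vs ! i))) $ i
      = (\<Sum>j<n. if (vs ! i, vs ! j) \<in> parcs G then x (vs ! j) else 0)"
    using i by (auto simp: adjacency_mat_def scalar_prod_def n_def lessThan_atLeast0 intro!: sum.cong)
  also have "\<dots> = (\<Sum>w\<in>pverts G. if (vs ! i, w) \<in> parcs G then x w else 0)"
    using assms bij_betw_nth[of vs "{..<n}" "pverts G"] by (intro sum.reindex_bij_betw) auto
  also have "\<dots> = (\<Sum>w\<in>nb (pverts G) (vs ! i). x w)"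
    unfolding nb_def using finite_V by (simp add: sum.inter_filter)
  finally show "(adjacency_mat G vs *\<^sub>v vec n (\<lambda>i. x (vs ! i))) $ i
      = vec n (\<lambda>i. \<Sum>w\<in>nb (pverts G) (vs ! i). x w) $ i"
    using i by simp
qed (simp add: adjacency_mat_def n_def)

lemma eigenvalue_adjacency_mat_iff:
  assumes G: "pair_graph G" and vs: "distinct vs" "set vs = pverts G"
  shows "eigenvalue (adjacency_mat G vs) k
    \<longleftrightarrow> (\<exists>x. finite_sym_rel.is_eigen (pverts G) (parcs G) k x)"
proof -
  interpret finite_sym_rel "pverts G" "parcs G" by (rule pair_graph_finite_sym_rel) fact
  define n where "n = length vs"
  have dim: "dim_row (adjacency_mat G vs) = n" by (simp add: adjacency_mat_def n_def)
  have iff: "eigenvector (adjacency_mat G vs) (vec n (\<lambda>i. x (vs ! i))) k \<longleftrightarrow> is_eigen k x" for x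
  proof -
    have "vec n (\<lambda>i. x (vs ! i)) \<noteq> 0\<^sub>v n \<longleftrightarrow> (\<exists>v\<in>pverts G. x v \<noteq> 0)"
      unfolding vs(2)[symmetric] by (auto simp: vec_eq_iff set_conv_nth n_def)
    moreover have "adjacency_mat G vs *\<^sub>v vec n (\<lambda>i. x (vs ! i)) = k \<cdot>\<^sub>v vec n (\<lambda>i. x (vs ! i))
        \<longleftrightarrow> (\<forall>v\<in>pverts G. (\<Sum>w\<in>nb (pverts G) v. x w) = k * x v)"
      unfolding n_def adjacency_mat_mult_vec[OF G vs] unfolding vs(2)[symmetric]
      by (auto simp: vec_eq_iff set_conv_nth)
    ultimately show ?thesis by (simp add: eigenvector_def is_eigen_def dim)
  qed
  show ?thesis
  proof
    assume "eigenvalue (adjacency_mat G vs) k"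
    then obtain v where v: "eigenvector (adjacency_mat G vs) v k" by (auto simp: eigenvalue_def)
    define x where "x w = v $ the_inv_into {..<n} ((!) vs) w" for w
    have "v = vec n (\<lambda>i. x (vs ! i))"
    proof (rule eq_vecI)
      fix i assume "i < dim_vec (vec n (\<lambda>i. x (vs ! i)))"
      then show "v $ i = vec n (\<lambda>i. x (vs ! i)) $ i"
        using vs(1) by (simp add: x_def n_def the_inv_into_f_f inj_on_nth)
    qed (use v in \<open>simp add: eigenvector_def dim\<close>)
    with v iff show "\<exists>x. is_eigen k x" by metis
  next
    assume "\<exists>x. is_eigen k x"
    then show "eigenvalue (adjacency_mat G vs) k" using iff unfolding eigenvalue_def by blast
  qed
qed

text \<open>Eigenvalues are roots of the nonzero characteristic polynomial, so the set under
  \<open>Max\<close> is finite, and the Rayleigh maximum is its largest element.\<close>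

lemma ex_perron_vector:
  assumes G: "pair_graph G" and ne: "pverts G \<noteq> {}"
  obtains x where "finite_sym_rel.is_eigen (pverts G) (parcs G) (adj_spectral_radius G) x"
    and "\<And>v. 0 \<le> x v"
proof -
  interpret finite_sym_rel "pverts G" "parcs G" by (rule pair_graph_finite_sym_rel) fact
  define vs where "vs = (SOME vs. distinct vs \<and> set vs = pverts G)"
  have "\<exists>vs. distinct vs \<and> set vs = pverts G"
    using finite_distinct_list[OF finite_V] by blast
  then have "distinct vs \<and> set vs = pverts G" unfolding vs_def by (rule someI_ex)
  then have vs: "distinct vs" "set vs = pverts G" by auto
  define A where "A = adjacency_mat G vs"
  have A: "A \<in> carrier_mat (length vs) (length vs)" by (simp add: A_def adjacency_mat_def)
  have "char_poly A \<noteq> 0" using degree_monic_char_poly[OF A] by auto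
  then have fin: "finite {k. eigenvalue A k}"
    unfolding eigenvalue_root_char_poly[OF A] by (rule poly_roots_finite)
  obtain \<mu> x where x: "is_eigen \<mu> x" "\<And>v. 0 \<le> x v" and max: "\<And>k y. is_eigen k y \<Longrightarrow> k \<le> \<mu>"
    using ex_nonneg_top_eigenvector[OF ne] by blast
  have "adj_spectral_radius G = Max {k. eigenvalue A k}"
    by (simp add: adj_spectral_radius_def A_def vs_def)
  also have "\<dots> = \<mu>"
    using fin x max unfolding A_def eigenvalue_adjacency_mat_iff[OF G vs] by (intro Max_eqI) auto
  finally show ?thesis using x that by simp
qed

section \<open>Isomorphisms, forbidden books and connectedness\<close>

lemma digraph_iso_pairI:
  assumes "pair_wf_digraph G" "inj_on h (pverts G)"
    and "pverts H = h ` pverts G" "parcs H = map_prod h h ` parcs G"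
  shows "digraph_iso (with_proj G) (with_proj H)"
proof -
  interpret pair_wf_digraph G by fact
  define f where "f = \<lparr>iso_verts = h, iso_arcs = map_prod h h, iso_head = snd, iso_tail = fst\<rparr>"
  have "inj_on (map_prod h h) (parcs G)"
  proof (rule inj_on_subset)
    show "inj_on (map_prod h h) (pverts G \<times> pverts G)" using assms(2) by (simp add: map_prod_inj_on)
    show "parcs G \<subseteq> pverts G \<times> pverts G" using in_arcsD1 in_arcsD2 by auto
  qed
  then have "pre_digraph.digraph_isomorphism (with_proj G) f"
    using assms(2) wf_digraph_axioms
    unfolding pre_digraph.digraph_isomorphism_def by (simp add: f_def)
  moreover have "with_proj H = app_iso f (with_proj G)"
    using assms(3,4) by (simp add: with_proj_def app_iso_def f_def)
  ultimately show ?thesis unfolding digraph_iso_def by blast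
qed

text \<open>Any r + 1 common neighbours of v and w serve as the apexes of a book with common edge
  vw.\<close>

lemma book_free_codegree:
  assumes G: "pair_graph G" and free: "book_free (r + 1) G" and vw: "(v, w) \<in> parcs G"
  shows "card {z. (v, z) \<in> parcs G \<and> (w, z) \<in> parcs G} \<le> r"
proof (rule ccontr)
  interpret pair_graph G by fact
  let ?C = "{z. (v, z) \<in> parcs G \<and> (w, z) \<in> parcs G}"
  assume "\<not> card ?C \<le> r"
  then obtain C where C: "C \<subseteq> ?C" "card C = r + 1" "finite C"
    using obtain_subset_with_card_n[of "r + 1" ?C] by auto
  then obtain f where f: "bij_betw f {2..<r + 3} C"
    using finite_same_card_bij[of "{2..<r + 3}" C] by auto
  define h where "h i = (if i = 0 then v else if i = 1 then w else f i)" for i :: nat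
  define H where "H = \<lparr>pverts = h ` pverts (book (r + 1)),
    parcs = map_prod h h ` parcs (book (r + 1))\<rparr>"
  have fC: "f i \<in> C" if "2 \<le> i" "i < r + 3" for i
    using f that by (auto simp: bij_betw_def)
  have notin: "v \<notin> C" "w \<notin> C" "v \<noteq> w" using C vw no_loops' by auto
  have inj: "inj_on h (pverts (book (r + 1)))"
  proof (rule inj_onI)
    fix i j assume "i \<in> pverts (book (r + 1))" "j \<in> pverts (book (r + 1))" "h i = h j"
    moreover have "inj_on f {2..<r + 3}" using f by (simp add: bij_betw_def)
    ultimately show "i = j"
      using notin fC[of i] fC[of j]
      by (auto simp: h_def book_def split: if_splits dest: inj_onD)
  qed
  have arcs: "parcs H \<subseteq> parcs G"
  proof -
    have "(v, f i) \<in> parcs G" "(w, f i) \<in> parcs G" "(f i, v) \<in> parcs G" "(f i, w) \<in> parcs G"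
      if "2 \<le> i" "i < r + 3" for i
      using fC[OF that] C(1) by (auto intro: arcs_symmetric)
    then show ?thesis
      using vw arcs_symmetric[OF vw] by (auto simp: H_def book_def h_def)
  qed
  have verts: "pverts H \<subseteq> pverts G"
  proof -
    have "f i \<in> pverts G" if "2 \<le> i" "i < r + 3" for i
      using fC[OF that] C(1) in_arcsD2 by auto
    moreover have "v \<in> pverts G" "w \<in> pverts G" using in_arcsD1[OF vw] in_arcsD2[OF vw] by auto
    ultimately show ?thesis by (auto simp: H_def book_def h_def)
  qed
  have "pair_wf_digraph (book (r + 1))" using pair_graph_book[of "r + 1"]
    by (simp add: pair_graph_def pair_digraph_def pair_fin_digraph_def)
  then have "digraph_iso (with_proj (book (r + 1))) (with_proj H)"
    using inj by (intro digraph_iso_pairI[where h = h]) (auto simp: H_def)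
  moreover have "subgraph (with_proj H) (with_proj G)"
  proof -
    have "wf_digraph (with_proj H)"
      unfolding wf_digraph_wp_iff
      by unfold_locales (auto simp: H_def book_def)
    then show ?thesis
      using arcs verts wf_digraph_axioms by (simp add: subgraph_def compatible_def)
  qed
  ultimately show False using free unfolding book_free_def by blast
qed

lemma connected_cut:
  assumes G: "pair_graph G" and conn: "Digraph_Component.connected (with_proj G)"
    and S: "S \<subseteq> pverts G" "S \<noteq> {}" "S \<noteq> pverts G"
  obtains v w where "v \<in> S" "w \<in> pverts G - S" "(v, w) \<in> parcs G"
proof -
  interpret pair_graph G by fact
  obtain a b where ab: "a \<in> S" "b \<in> pverts G" "b \<notin> S" using S by auto
  have "(a, b) \<in> rtrancl_on (pverts G) ((parcs G)\<^sup>s)"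
    using conn ab S unfolding connected_conv by auto
  then have "b \<in> S \<or> (\<exists>v\<in>S. \<exists>w\<in>pverts G - S. (v, w) \<in> parcs G)"
  proof (induction rule: rtrancl_on_induct)
    case (step y z)
    then have "(y, z) \<in> parcs G" by (auto simp: symcl_def intro: arcs_symmetric)
    then show ?case using step.IH in_arcsD2 by blast
  qed (use ab in auto)
  then show ?thesis using ab that by auto
qed

text \<open>The extra edge of \<open>S_plus\<close> joins s and s + 1, so a and b are sent there;
  the rest of \<open>B\<close> and the set \<open>A\<close> are matched arbitrarily by
  cardinality.\<close>

lemma digraph_iso_S_plusI:
  assumes G: "pair_graph G"
    and verts: "pverts G = A \<union> B" "A \<inter> B = {}"
    and ab: "a \<in> B" "b \<in> B" "a \<noteq> b"
    and arcs: "parcs G = A \<times> B \<union> B \<times> A \<union> {(a, b), (b, a)}"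
    and s: "0 < card A" and m: "m = card A * card B + 1"
  shows "digraph_iso (with_proj G) (with_proj (S_plus m (card A)))"
proof -
  interpret pair_graph G by fact
  define s where "s = card A"
  define t where "t = card B"
  have fin: "finite A" "finite B" using pair_finite_verts verts by auto
  have t: "(m - 1) div s = t" using s m by (simp add: s_def t_def)
  have "card {a, b} \<le> t" unfolding t_def using ab fin by (intro card_mono) auto
  then have t2: "2 \<le> t" using ab by simp
  have "\<exists>f. bij_betw f A {..<s}"
    by (rule finite_same_card_bij) (simp_all add: fin s_def)
  then obtain f where f: "bij_betw f A {..<s}" by blast
  have "card (B - {a, b}) = t - 2" using ab fin by (simp add: t_def card_Diff_subset)
  then have "\<exists>g. bij_betw g (B - {a, b}) {s + 2..<s + t}"
    by (intro finite_same_card_bij) (simp_all add: fin)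
  then obtain g where g: "bij_betw g (B - {a, b}) {s + 2..<s + t}" by blast
  define gB where "gB v = (if v = a then s else if v = b then s + 1 else g v)" for v
  have "bij_betw gB ({a, b} \<union> (B - {a, b})) ({s, s + 1} \<union> {s + 2..<s + t})"
  proof (rule bij_betw_combine)
    show "bij_betw gB {a, b} {s, s + 1}" using ab by (auto simp: bij_betw_def gB_def)
    show "bij_betw gB (B - {a, b}) {s + 2..<s + t}"
      using g by (rule bij_betw_cong[THEN iffD1, rotated]) (auto simp: gB_def)
  qed auto
  moreover have "{a, b} \<union> (B - {a, b}) = B" using ab by auto
  moreover have "{s, s + 1} \<union> {s + 2..<s + t} = {s..<s + t}" using t2 by auto
  ultimately have gB: "bij_betw gB B {s..<s + t}" by simp
  define h where "h v = (if v \<in> A then f v else gB v)" for v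
  have hA: "bij_betw h A {..<s}"
    using f by (rule bij_betw_cong[THEN iffD1, rotated]) (auto simp: h_def)
  have hB: "bij_betw h B {s..<s + t}"
    using gB verts(2) by (intro bij_betw_cong[THEN iffD1, OF _ gB]) (auto simp: h_def)
  have h: "bij_betw h (pverts G) ({..<s} \<union> {s..<s + t})"
    unfolding verts(1) using hA hB by (rule bij_betw_combine) auto
  have img: "h ` A = {..<s}" "h ` B = {s..<s + t}" using hA hB by (auto simp: bij_betw_def)
  have hab: "h a = s" "h b = s + 1" using ab verts(2) by (auto simp: h_def gB_def)
  have prod: "map_prod h h ` (X \<times> Y) = h ` X \<times> h ` Y" for X Y by auto
  show ?thesis
  proof (rule digraph_iso_pairI)
    show "pair_wf_digraph G" by (rule pair_wf_digraph)
    show "inj_on h (pverts G)" using h by (auto simp: bij_betw_def)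
    show "pverts (S_plus m (card A)) = h ` pverts G"
      using h t by (auto simp: S_plus_def Let_def complete_bipartite_def s_def bij_betw_def)
    show "parcs (S_plus m (card A)) = map_prod h h ` parcs G"
      unfolding arcs image_Un prod img using hab t
      by (simp add: S_plus_def Let_def complete_bipartite_def s_def)
  qed
qed

section \<open>The contradiction and the exceptional graphs\<close>

theorem theorem1p4:
  fixes G :: "'a pair_pre_digraph" and r m :: nat and \<rho> :: real
  assumes "r \<ge> 1"
    and "pair_graph G"
    and "Digraph_Component.connected G"
    and "\<not> bipartite G"
    and "m = card (edges G)"
    and "m \<ge> (240 * r)^2"
    and "\<rho> = adj_spectral_radius G"
    and "book_free (r + 1) G"
    and "\<not> (\<exists>s \<in> {1..r}. s dvd m - 1 \<and> digraph_iso G (S_plus m s))"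
  shows "\<rho>^2 < real m - 1 + 2 / (\<rho> - 1)"
proof (rule ccontr)
  assume large: "\<not> \<rho>^2 < real m - 1 + 2 / (\<rho> - 1)"
  interpret G: pair_graph G by fact
  interpret finite_sym_rel "pverts G" "parcs G" by (rule pair_graph_finite_sym_rel) fact
  have "pverts G \<noteq> {}" using assms(3) by (simp add: connected_conv)
  then obtain x0 where x0: "is_eigen \<rho> x0" "\<And>v. 0 \<le> x0 v"
    using ex_perron_vector[OF assms(2)] assms(7) by metis
  have "Max (x0 ` pverts G) \<in> x0 ` pverts G"
    using finite_V \<open>pverts G \<noteq> {}\<close> by (intro Max_in) auto
  then obtain u where u: "u \<in> pverts G" "x0 u = Max (x0 ` pverts G)" by auto
  have x0_le: "x0 v \<le> x0 u" if "v \<in> pverts G" for v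
    using that finite_V by (simp add: u(2))
  have x0_u: "0 < x0 u"
  proof -
    obtain v where "v \<in> pverts G" "x0 v \<noteq> 0" using x0(1) by (auto simp: is_eigen_def)
    then show ?thesis using x0(2)[of v] x0_le[of v] by linarith
  qed
  define x where "x v = x0 v / x0 u" for v
  interpret perron "pverts G" "parcs G" x \<rho> u
  proof (unfold_locales)
    show "(v, v) \<notin> parcs G" for v using G.no_loops' by blast
    show "(\<Sum>w\<in>nb (pverts G) v. x w) = \<rho> * x v" if "v \<in> pverts G" for v
      using x0(1) that by (simp add: x_def is_eigen_def flip: sum_divide_distrib)
  qed (use u x0_u x0 x0_le in \<open>auto simp: x_def\<close>)
  \<comment> \<open>Otherwise \<open>insert u W\<close> and \<open>N\<close> would be the two sides
    of a bipartition.\<close>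
  have odd: "(\<exists>v\<in>N. nb N v \<noteq> {}) \<or> (\<exists>z\<in>W. nb W z \<noteq> {})"
  proof (rule ccontr)
    assume no_arcs: "\<not> ?thesis"
    have "parcs G \<subseteq> insert u W \<times> N \<union> N \<times> insert u W"
    proof (rule subrelI)
      fix v w assume vw: "(v, w) \<in> parcs G"
      have "v \<in> insert u (N \<union> W)" "w \<in> insert u (N \<union> W)" using E_V[OF vw] V_eq by auto
      then show "(v, w) \<in> insert u W \<times> N \<union> N \<times> insert u W"
        using vw no_arcs E_u E_commute[of v w] u_notin by (auto simp: nb_def)
    qed
    moreover have "pverts G = insert u W \<union> N" "insert u W \<inter> N = {}"
      using V_eq u_notin N_W_disjoint by auto
    ultimately show False using assms(4) unfolding bipartite_def by blast
  qed
  have W_nb: "w \<in> N" if "z \<in> W" "(z, w) \<in> parcs G" "w \<notin> W" for z w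
  proof -
    have "w \<noteq> u" using that E_u[of z] E_commute[of z w] N_W_disjoint by auto
    then show ?thesis using that E_V(2)[OF that(2)] V_eq by auto
  qed
  \<comment> \<open>This fixes the sign of 2 / (\<rho> - 1), so that the negated bound gives
    \<rho>^2 > m - 1.\<close>
  have "1 < \<rho>"
  proof (cases "\<exists>v\<in>N. nb N v \<noteq> {}")
    case True
    then show ?thesis using rho_gt_1 by blast
  next
    case False
    then have "W \<noteq> {}" using odd by auto
    moreover have "W \<noteq> pverts G" using u(1) u_notin by auto
    ultimately obtain z v where zv: "z \<in> W" "v \<in> pverts G - W" "(z, v) \<in> parcs G"
      using connected_cut[OF assms(2,3) W_subset] by metis
    then have "v \<in> N" using W_nb by auto
    moreover have "z \<in> nb W v" using zv E_commute by (simp add: nb_def)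
    ultimately show ?thesis using rho_gt_1 by blast
  qed
  then have "0 < 2 / (\<rho> - 1)" by simp
  with large have rho_sq_gt: "real m - 1 < \<rho>^2" by linarith
  have "239 * real r \<le> \<rho>"
  proof (rule power2_le_imp_le)
    \<comment> \<open>The drop from 240 to 239 absorbs the -1 in m - 1: 57600 - 1 \<ge>
      239^2.\<close>
    have "real ((240 * r)^2) \<le> real m" using assms(6) of_nat_mono by blast
    then have "57600 * (real r)^2 \<le> real m" by (simp add: power_mult_distrib)
    moreover have "1 \<le> (real r)^2" using assms(1) by simp
    ultimately show "(239 * real r)^2 \<le> \<rho>^2"
      using rho_sq_gt by (simp add: power_mult_distrib)
    show "0 \<le> \<rho>" by (rule rho_ge_0)
  qed
  then interpret book_free_perron "pverts G" "parcs G" x \<rho> u r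
  proof (unfold_locales)
    fix v w assume vw: "(v, w) \<in> parcs G"
    have "nb (pverts G) v \<inter> nb (pverts G) w = {z. (v, z) \<in> parcs G \<and> (w, z) \<in> parcs G}"
      using E_V by (auto simp: nb_def)
    then show "card (nb (pverts G) v \<inter> nb (pverts G) w) \<le> r"
      using book_free_codegree[OF assms(2,8) vw] by simp
  qed (use assms(1) in auto)
  have small: "arc_term + 2 * sum loss W < 2"
    using deficit card_parcs[OF assms(2)] rho_sq_gt assms(5) by simp
  have iso: "nb W z = {}" if "z \<in> W" for z
    using W_arc_deficit[OF that] small by auto
  then obtain a b where ab: "a \<in> N" "b \<in> nb N a" using odd by auto
  then have bN: "b \<in> N" and "a \<noteq> b" and ab_arc: "(a, b) \<in> parcs G"
    using irrefl_E by (auto simp: nb_def)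
  have no_isolated: "nb N z \<noteq> {}" if z: "z \<in> W" for z
  proof -
    have "{z} \<noteq> pverts G" using z u(1) u_notin by auto
    then obtain w where w: "(z, w) \<in> parcs G"
      using connected_cut[OF assms(2,3), of "{z}"] z W_subset by auto
    then have "w \<notin> W" using iso[OF z] by (auto simp: nb_def)
    then have "w \<in> N" using W_nb z w by blast
    then show ?thesis using w by (auto simp: nb_def)
  qed
  \<comment> \<open>Like every vertex of \<open>W\<close>, u is adjacent to exactly the vertices of
    \<open>N\<close>, so it completes the side of size s.\<close>
  define A where "A = insert u W"
  have A_N: "(v, w) \<in> parcs G" "(w, v) \<in> parcs G" if "v \<in> A" "w \<in> N" for v w
    using that W_N_complete[OF iso small ab no_isolated] E_u E_commute[of v w]
    by (auto simp: A_def)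
  have verts: "pverts G = A \<union> N" "A \<inter> N = {}"
    using V_eq u_notin N_W_disjoint by (auto simp: A_def)
  have finite_A: "finite A" using finite_W by (simp add: A_def)
  have no_A_arcs: "(v, w) \<notin> parcs G" if "v \<in> A" "w \<in> A" for v w
    using that iso irrefl_E E_u E_commute[of v w] N_W_disjoint by (auto simp: A_def nb_def)
  have N_arcs: "Sigma N (nb N) = {(a, b), (b, a)}"
    by (rule N_arcs_eq[OF iso small ab])
  have arcs: "parcs G = A \<times> N \<union> N \<times> A \<union> {(a, b), (b, a)}"
  proof
    show "A \<times> N \<union> N \<times> A \<union> {(a, b), (b, a)} \<subseteq> parcs G"
      using A_N ab_arc E_commute by auto
    show "parcs G \<subseteq> A \<times> N \<union> N \<times> A \<union> {(a, b), (b, a)}"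
    proof (rule subrelI)
      fix v w assume vw: "(v, w) \<in> parcs G"
      have "v \<in> A \<union> N" "w \<in> A \<union> N" using E_V[OF vw] verts by auto
      moreover have "(v, w) \<in> {(a, b), (b, a)}" if "v \<in> N" "w \<in> N"
      proof -
        have "(v, w) \<in> Sigma N (nb N)" using that vw by (simp add: nb_def)
        then show ?thesis unfolding N_arcs .
      qed
      ultimately show "(v, w) \<in> A \<times> N \<union> N \<times> A \<union> {(a, b), (b, a)}"
        using no_A_arcs vw by blast
    qed
  qed
  have "2 * m = 2 * (card A * card N + 1)"
  proof -
    have "card (parcs G) = card (A \<times> N \<union> N \<times> A \<union> {(a, b), (b, a)})"
      using arcs by (rule arg_cong)
    also have "\<dots> = card (A \<times> N \<union> N \<times> A) + card {(a, b), (b, a)}"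
      using ab bN verts(2) finite_A finite_N by (intro card_Un_disjoint) auto
    also have "card (A \<times> N \<union> N \<times> A) = card (A \<times> N) + card (N \<times> A)"
      using verts(2) finite_A finite_N by (intro card_Un_disjoint) auto
    finally show ?thesis
      using card_parcs[OF assms(2)] assms(5) \<open>a \<noteq> b\<close> by (simp add: card_cartesian_product)
  qed
  then have m: "m = card A * card N + 1" by simp
  \<comment> \<open>The codegree bound at the edge ab limits the side \<open>A\<close>, which gives
    s \<le> r.\<close>
  have "A \<subseteq> nb (pverts G) a \<inter> nb (pverts G) b"
    using A_N ab bN verts by (auto simp: nb_def)
  then have "card A \<le> card (nb (pverts G) a \<inter> nb (pverts G) b)"
    using finite_V by (intro card_mono) (auto simp: finite_nb)
  then have "card A \<le> r" using codegree_le[OF ab_arc] by linarith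
  moreover have A_pos: "0 < card A" using finite_A by (auto simp: A_def card_gt_0_iff)
  moreover have "digraph_iso G (S_plus m (card A))"
    using assms(2) verts ab(1) bN \<open>a \<noteq> b\<close> arcs A_pos m by (rule digraph_iso_S_plusI)
  moreover have "card A dvd m - 1" using m by simp
  ultimately show False using assms(9) by (auto simp: Suc_le_eq)
qed

end
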